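(* Consider $k$ open quadratic programs. For $i=1,\dots,k$ the $i$-th one has input $u_i$, decision variable $x_i$, data $P_i$ (symmetric), $q_i,N_i,A_i,M_i,b_i$, KKT matrix $K_i$, signal space $\mathbb{W}_i$ and behavior $\mathcal{B}_i\subseteq\mathbb{W}_i$. Let $\mathcal{C}\subseteq\mathbb{W}=\mathbb{W}_1\times\cdots\times\mathbb{W}_k$ be an interconnection and let $$\mathcal{B}=\mathcal{C}\cap\bigcap_{i=1}^k\pi_i^{-1}(\mathcal{B}_i)$$ be the interconnected behavior. Assume $P_i\succeq0$ and $K_i$ nonsingular for $i=1,\dots,k$. Let $D_0,d_0$ and $D_i,d_i$ be such that $\mathcal{C}=\{w\in\mathbb{W}\mid D_0w=d_0\}$ and $\mathcal{B}_i=\{w_i\in\mathbb{W}_i\mid D_iw_i=d_i\}$, and let $D$ and $d$ be the stacked matrix and vector $$D=\begin{bmatrix} D_0 \\ D_1\pi_1 \\ \vdots \\ D_k\pi_k \end{bmatrix},\qquad d=\begin{bmatrix} d_0 \\ d_1 \\ \vdots \\ d_k \end{bmatrix},$$ so that $\mathcal{B}=\{w\in\mathbb{W}\mid Dw=d\}$. Let $w=(w_{\mathrm{in}},w_{\mathrm{out}})$ be a partition of the components of $w$, and let $D=\begin{bmatrix} D_{\mathrm{in}} & D_{\mathrm{out}} \end{bmatrix}$ be the corresponding column partition. Then the following statements hold. (i) $\mathcal{B}$ is the behavior of an open quadratic program with input $w_{\mathrm{in}}$, decision variable $w_{\mathrm{out}}$, and nonsingular KKT matrix if and only if $\mathcal{B}\neq\emptyset$,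 $D_{\mathrm{out}}$ has full column rank, and $\operatorname{image}D_{\mathrm{in}}\subseteq\operatorname{image}D_{\mathrm{out}}$. (ii) $\mathcal{B}$ is a singleton if and only if $Dw=d$ is consistent and $D$ has full column rank. (iii) If the interconnection has a single loop, with loop map $\Xi$, vector $b_\star$, and associated $R_\star,E,e$, then $\mathcal{B}$ is a singleton if and only if $1\notin\sigma(\Xi)$. In that case the unique element $w$ of $\mathcal{B}$ satisfies $w_\star=(I-\Xi)^{-1}b_\star$ and $w=Ew_\star+e$, where $w_\star=R_\star w$.
   Context: An open quadratic program with input $u\in\mathbb{R}^m$ and decision variable $x\in\mathbb{R}^n$ is a program $$\min_{x\in\mathbb{R}^n}\ \tfrac12 x^{\mathsf T}Px+(q+Nu)^{\mathsf T}x\quad\text{s.t.}\quad Ax+Mu=b,$$ with $P\in\mathbb{R}^{n\times n}$ symmetric positive semidefinite, $q\in\mathbb{R}^n$, $N\in\mathbb{R}^{n\times m}$, $A\in\mathbb{R}^{p\times n}$, $M\in\mathbb{R}^{p\times m}$, $b\in\mathbb{R}^p$, where $p\ge0$ (the case $p=0$ means no constraints). Its KKT matrix is $K=\begin{bmatrix} P & A^{\mathsf T} \\ A & 0 \end{bmatrix}$ (with $K=P$ if $p=0$). Its signal space is $\mathbb{R}^m\times\mathbb{R}^n$, with elements $w=(u,x)$. Its behavior is the graph of the solution map, $\{(u,x)\mid x \text{ is a minimizer of the program for input }u\}$. When $P\succeq0$ and $K$ is nonsingular, the behavior is an affine subspace of the signal space. For $k$ programs, $\pi_i:\mathbb{W}\to\mathbb{W}_i$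 is the projection onto the variables $w_i=(u_i,x_i)$ of the $i$-th program. An interconnection is an affine subspace $\mathcal{C}\subseteq\mathbb{W}$, given by affine equations $D_0w=d_0$; the intended meaning is that these equations identify variables of distinct programs (variable sharing). Single loop: let $R_\star$ be a matrix selecting a block $w_\star=R_\star w$ of the components of $w$. The interconnection has a single loop if there exist matrices $E$, $\Xi$ (with $\Xi$ square) and vectors $e$, $b_\star$, with $R_\star E=I$ and $R_\star e=0$, such that $\mathcal{B}=\{Ez+e\mid z=\Xi z+b_\star\}$. The matrix $\Xi$ is then called the loop map. $\sigma(X)$ denotes the spectrum (set of complex eigenvalues) of a square matrix $X$. *)

theory Defs
  imports
    "Jordan_Normal_Form.DL_Rank"
    "Jordan_Normal_Form.Gauss_Jordan_Elimination"
    "Jordan_Normal_Form.Spectral_Radius"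
begin

section \<open>Open quadratic programs\<close>

text \<open>
  All dimensions are carried by the matrices and vectors themselves and may be zero.
  In particular a program without constraints has \<open>dim_vec (qp_b Q) = 0\<close>, and then
  \<open>qp_A Q\<close> and \<open>qp_M Q\<close> have no rows and \<open>kkt_mat Q = qp_P Q\<close>.
\<close>

record open_qp =
  qp_P :: "real mat"
  qp_q :: "real vec"
  qp_N :: "real mat"
  qp_A :: "real mat"
  qp_M :: "real mat"
  qp_b :: "real vec"

definition dim_in :: "open_qp \<Rightarrow> nat" where
  "dim_in Q = dim_col (qp_N Q)"

definition dim_dec :: "open_qp \<Rightarrow> nat" where
  "dim_dec Q = dim_vec (qp_q Q)"

definition dim_con :: "open_qp \<Rightarrow> nat" where
  "dim_con Q = dim_vec (qp_b Q)"

definition sym_psd_mat :: "real mat \<Rightarrow> bool" where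
  "sym_psd_mat P \<longleftrightarrow> P\<^sup>T = P \<and> (\<forall>x \<in> carrier_vec (dim_row P). 0 \<le> x \<bullet> (P *\<^sub>v x))"

definition is_open_qp :: "open_qp \<Rightarrow> bool" where
  "is_open_qp Q \<longleftrightarrow>
     qp_P Q \<in> carrier_mat (dim_dec Q) (dim_dec Q) \<and> sym_psd_mat (qp_P Q) \<and>
     qp_N Q \<in> carrier_mat (dim_dec Q) (dim_in Q) \<and>
     qp_A Q \<in> carrier_mat (dim_con Q) (dim_dec Q) \<and>
     qp_M Q \<in> carrier_mat (dim_con Q) (dim_in Q)"

definition kkt_mat :: "open_qp \<Rightarrow> real mat" where
  "kkt_mat Q =
     four_block_mat (qp_P Q) ((qp_A Q)\<^sup>T) (qp_A Q) (0\<^sub>m (dim_con Q) (dim_con Q))"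

definition qp_objective :: "open_qp \<Rightarrow> real vec \<Rightarrow> real vec \<Rightarrow> real" where
  "qp_objective Q u x = 1 / 2 * (x \<bullet> (qp_P Q *\<^sub>v x)) + (qp_q Q + qp_N Q *\<^sub>v u) \<bullet> x"

definition qp_feasible :: "open_qp \<Rightarrow> real vec \<Rightarrow> real vec \<Rightarrow> bool" where
  "qp_feasible Q u x \<longleftrightarrow>
     x \<in> carrier_vec (dim_dec Q) \<and> qp_A Q *\<^sub>v x + qp_M Q *\<^sub>v u = qp_b Q"

definition qp_minimizer :: "open_qp \<Rightarrow> real vec \<Rightarrow> real vec \<Rightarrow> bool" where
  "qp_minimizer Q u x \<longleftrightarrow> is_arg_min (qp_objective Q u) (qp_feasible Q u) x"

text \<open>An element \<open>(u, x)\<close> of the signal space is represented by the concatenation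
  \<open>u @\<^sub>v x\<close>.\<close>

definition dim_sig :: "open_qp \<Rightarrow> nat" where
  "dim_sig Q = dim_in Q + dim_dec Q"

definition behavior :: "open_qp \<Rightarrow> real vec set" where
  "behavior Q = {u @\<^sub>v x | u x. u \<in> carrier_vec (dim_in Q) \<and> qp_minimizer Q u x}"


section \<open>Interconnections\<close>

text \<open>The signal space of the programs \<open>Q 0, \<dots>, Q (k - 1)\<close> consists of the concatenations
  of their signals, in this order.\<close>

definition dim_total :: "nat \<Rightarrow> (nat \<Rightarrow> open_qp) \<Rightarrow> nat" where
  "dim_total k Q = (\<Sum>i<k. dim_sig (Q i))"

definition proj_mat :: "nat \<Rightarrow> (nat \<Rightarrow> open_qp) \<Rightarrow> nat \<Rightarrow> real mat" where
  "proj_mat k Q i =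
     mat (dim_sig (Q i)) (dim_total k Q)
       (\<lambda>(r, c). if c = (\<Sum>j<i. dim_sig (Q j)) + r then 1 else 0)"

definition interconnected_behavior ::
    "nat \<Rightarrow> (nat \<Rightarrow> open_qp) \<Rightarrow> real vec set \<Rightarrow> real vec set" where
  "interconnected_behavior k Q C =
     C \<inter> (\<Inter>i<k. {w \<in> carrier_vec (dim_total k Q). proj_mat k Q i *\<^sub>v w \<in> behavior (Q i)})"

definition stack_mat :: "nat \<Rightarrow> 'a mat list \<Rightarrow> 'a mat" where
  "stack_mat nc As = mat_of_rows nc (concat (map rows As))"

definition stack_vec :: "'a vec list \<Rightarrow> 'a vec" where
  "stack_vec vs = vec_of_list (concat (map list_of_vec vs))"


section \<open>Selection of components\<close>

text \<open>A block of the components of a vector of dimension \<open>n\<close> is given by the list of its indices,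
  in an arbitrary order.\<close>

definition index_block :: "nat \<Rightarrow> nat list \<Rightarrow> bool" where
  "index_block n js \<longleftrightarrow> distinct js \<and> set js \<subseteq> {..<n}"

definition index_partition :: "nat \<Rightarrow> nat list \<Rightarrow> nat list \<Rightarrow> bool" where
  "index_partition n is js \<longleftrightarrow> distinct (is @ js) \<and> set (is @ js) = {..<n}"

definition select_vec :: "'a vec \<Rightarrow> nat list \<Rightarrow> 'a vec" where
  "select_vec w js = vec_of_list (map (\<lambda>j. w $ j) js)"

definition select_cols :: "'a mat \<Rightarrow> nat list \<Rightarrow> 'a mat" where
  "select_cols D js = mat_of_cols (dim_row D) (map (col D) js)"

definition is_selection_mat :: "nat \<Rightarrow> real mat \<Rightarrow> bool" where
  "is_selection_mat n R \<longleftrightarrow>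
     (\<exists>js. index_block n js \<and> R = mat_of_rows n (map (unit_vec n) js))"

definition full_column_rank :: "real mat \<Rightarrow> bool" where
  "full_column_rank D \<longleftrightarrow> vec_space.rank (dim_row D) D = dim_col D"

definition mat_image :: "real mat \<Rightarrow> real vec set" where
  "mat_image D = (\<lambda>x. D *\<^sub>v x) ` carrier_vec (dim_col D)"


section \<open>Single loops\<close>

definition single_loop ::
    "nat \<Rightarrow> real vec set \<Rightarrow> real mat \<Rightarrow> real mat \<Rightarrow> real vec \<Rightarrow> real mat \<Rightarrow> real vec \<Rightarrow> bool" where
  "single_loop n B R E e \<Xi> b \<longleftrightarrow>
     is_selection_mat n R \<and>
     E \<in> carrier_mat n (dim_row R) \<and> e \<in> carrier_vec n \<and>
     \<Xi> \<in> carrier_mat (dim_row R) (dim_row R) \<and> b \<in> carrier_vec (dim_row R) \<and>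
     R * E = 1\<^sub>m (dim_row R) \<and> R *\<^sub>v e = 0\<^sub>v (dim_row R) \<and>
     B = {E *\<^sub>v z + e | z. z \<in> carrier_vec (dim_row R) \<and> z = \<Xi> *\<^sub>v z + b}"

text \<open>The spectrum of a real matrix consists of its complex eigenvalues.\<close>

definition real_mat_spectrum :: "real mat \<Rightarrow> complex set" where
  "real_mat_spectrum X = spectrum (map_mat complex_of_real X)"

end

theory Submission
  imports Defs
begin

text \<open>Everything rests on the description of \<open>B\<close> as the solution set of \<open>D w = d\<close>.
  For (i), a program with nonsingular KKT matrix has exactly one minimizer for every input:
  a solution of the KKT system exists, and moving from it by a feasible \<open>v\<close> changes the
  objective by \<open>v \<bullet> P v / 2\<close>, which vanishes only if \<open>P v = 0\<close>, that is, only if \<open>(v, 0)\<close> is in the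
  kernel of the KKT matrix. So \<open>D\<^sub>i\<^sub>n u + D\<^sub>o\<^sub>u\<^sub>t x = d\<close> has exactly one solution \<open>x\<close> for every
  \<open>u\<close>, which is the rank and image condition. Conversely, under that condition \<open>B\<close> is the behavior of
  the unconstrained least-squares program minimizing \<open>|D\<^sub>i\<^sub>n u + D\<^sub>o\<^sub>u\<^sub>t x - d|\<^sup>2 / 2\<close>.
  For (iii), \<open>z \<mapsto> E z + e\<close> is injective with left inverse \<open>R\<close>, so \<open>B\<close> is a singleton iff
  \<open>(I - \<Xi>) z = b\<close> has exactly one solution.\<close>

section \<open>Linear algebra: nonsingularity and column rank expressed through kernels\<close>

section \<open>Kernels, invertibility and rank\<close>

lemma scalar_prod_self_nonneg: "0 \<le> v \<bullet> (v :: real vec)"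
  unfolding scalar_prod_def by (auto intro: sum_nonneg)

lemma scalar_prod_self_eq_0:
  assumes "v \<bullet> (v :: real vec) = 0"
  shows "v = 0\<^sub>v (dim_vec v)"
  using assms unfolding scalar_prod_def
  by (subst (asm) sum_nonneg_eq_0_iff) (auto intro!: eq_vecI)

lemma vec_add_diff_cancel:
  fixes x y :: "'a :: ab_group_add vec"
  assumes "x \<in> carrier_vec n" "y \<in> carrier_vec n"
  shows "x + y - y = x" "x - y + y = x"
  using assms by auto

lemma mat_mult_unit_vec:
  fixes A :: "'a :: semiring_1 mat"
  assumes "A \<in> carrier_mat n m" "j < m"
  shows "A *\<^sub>v unit_vec m j = col A j"
  using assms by (intro eq_vecI) auto

lemma invertible_mat_obtain_inverse:
  fixes K :: "'a :: semiring_1 mat"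
  assumes K: "K \<in> carrier_mat n n" "invertible_mat K"
  obtains J where "J \<in> carrier_mat n n" "K * J = 1\<^sub>m n" "J * K = 1\<^sub>m n"
proof -
  from K(2) obtain J where J: "inverts_mat J K" "inverts_mat K J"
    unfolding invertible_mat_def by blast
  have Jc: "J \<in> carrier_mat n n"
    using J K(1) unfolding inverts_mat_def
    by (metis carrier_matD carrier_matI index_mult_mat(2,3) index_one_mat(2,3))
  with J K(1) that show ?thesis unfolding inverts_mat_def by simp
qed

text \<open>A left inverse sends every kernel vector to zero; conversely the determinant vanishes
  only if some nonzero vector is killed. Nonsingularity of KKT matrices is both used and established
  in this form.\<close>

lemma invertible_mat_iff_trivial_kernel:
  fixes K :: "'a :: field mat"
  assumes K: "K \<in> carrier_mat n n"
  shows "invertible_mat K \<longleftrightarrow> (\<forall>v \<in> carrier_vec n. K *\<^sub>v v = 0\<^sub>v n \<longrightarrow> v = 0\<^sub>v n)"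
proof
  assume "invertible_mat K"
  then obtain J where J: "K * J = 1\<^sub>m n" "J * K = 1\<^sub>m n" and Jc: "J \<in> carrier_mat n n"
    using invertible_mat_obtain_inverse[OF K] by blast
  show "\<forall>v \<in> carrier_vec n. K *\<^sub>v v = 0\<^sub>v n \<longrightarrow> v = 0\<^sub>v n"
  proof (intro ballI impI)
    fix v assume v: "v \<in> carrier_vec n" "K *\<^sub>v v = 0\<^sub>v n"
    have "v = (J * K) *\<^sub>v v" using J v by simp
    also have "\<dots> = J *\<^sub>v 0\<^sub>v n" using Jc K v by simp
    also have "\<dots> = 0\<^sub>v n" using Jc by auto
    finally show "v = 0\<^sub>v n" .
  qed
next
  assume "\<forall>v \<in> carrier_vec n. K *\<^sub>v v = 0\<^sub>v n \<longrightarrow> v = 0\<^sub>v n"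
  then have "det K \<noteq> 0" using det_0_iff_vec_prod_zero[OF K] by auto
  \<comment> \<open>The argument \<open>()\<close> fills the record extension of
    \<open>ring_mat\<close>; the units of that ring are the invertible matrices.\<close>
  from det_non_zero_imp_unit[OF K this, of "()"] show "invertible_mat K"
    using K unfolding Units_def ring_mat_def invertible_mat_def inverts_mat_def by auto
qed

lemma invertible_mat_solution:
  fixes K :: "'a :: field mat"
  assumes K: "K \<in> carrier_mat n n" "invertible_mat K" and y: "y \<in> carrier_vec n"
  obtains x where "x \<in> carrier_vec n" "K *\<^sub>v x = y"
proof -
  obtain J where J: "K * J = 1\<^sub>m n" and Jc: "J \<in> carrier_mat n n"
    using invertible_mat_obtain_inverse[OF K] by blast
  have "K *\<^sub>v (J *\<^sub>v y) = (K * J) *\<^sub>v y" using K Jc y by simp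
  also have "\<dots> = y" using J y by simp
  finally show ?thesis using that[of "J *\<^sub>v y"] Jc y by auto
qed

text \<open>Linear independence concerns the set of columns, in which repetitions are lost, so each
  direction first shows that the columns are distinct.\<close>

lemma full_column_rank_iff_trivial_kernel:
  assumes D: "D \<in> carrier_mat n m"
  shows "full_column_rank D \<longleftrightarrow> (\<forall>v \<in> carrier_vec m. D *\<^sub>v v = 0\<^sub>v n \<longrightarrow> v = 0\<^sub>v m)"
proof -
  interpret vec_space "TYPE(real)" n .
  have fcr: "full_column_rank D \<longleftrightarrow> rank D = m"
    using D unfolding full_column_rank_def by auto
  have colsD: "length (cols D) = m" using D by simp
  show ?thesis
  proof
    assume "full_column_rank D"
    then have r: "rank D = m" using fcr by simp
    \<comment> \<open>A maximal independent set of columns has as many elements as the rank, namely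
      \<open>m\<close>, so the \<open>m\<close> columns cannot repeat.\<close>
    obtain S where S: "maximal S (\<lambda>T. T \<subseteq> set (cols D) \<and> lin_indpt T)"
      using maximal_exists[of "(\<lambda>T. T \<subseteq> set (cols D) \<and> lin_indpt T)" "card (set (cols D))" "{}"]
      by (meson List.finite_set card_mono empty_iff empty_subsetI finite_lin_indpt2 rev_finite_subset)
    then have "card S \<le> card (set (cols D))" by (simp add: card_mono maximal_def)
    then have "m \<le> card (set (cols D))" using rank_card_indpt[OF D S] r by simp
    then have "distinct (cols D)"
      using colsD by (metis card_distinct card_length le_antisym)
    then show "\<forall>v \<in> carrier_vec m. D *\<^sub>v v = 0\<^sub>v n \<longrightarrow> v = 0\<^sub>v m"
      using full_rank_lin_indpt[OF D r] lin_depI[OF D] by blast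
  next
    assume ker: "\<forall>v \<in> carrier_vec m. D *\<^sub>v v = 0\<^sub>v n \<longrightarrow> v = 0\<^sub>v m"
    have dist: "distinct (cols D)"
    proof (rule ccontr)
      assume "\<not> distinct (cols D)"
      then obtain i j where ij: "i < m" "j < m" "i \<noteq> j" "col D i = col D j"
        using D by (auto simp: distinct_conv_nth)
      \<comment> \<open>Equal columns \<open>i\<close> and \<open>j\<close> would make this
        difference a nonzero kernel vector.\<close>
      let ?v = "unit_vec m i - unit_vec m j :: real vec"
      have "D *\<^sub>v ?v = col D i - col D j"
        using D ij by (simp add: mult_minus_distrib_mat_vec mat_mult_unit_vec)
      also have "\<dots> = 0\<^sub>v n" using D ij(4) by auto
      finally have "?v = 0\<^sub>v m" using ker by auto
      then have "?v $ i = 0" using ij by simp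
      then show False using ij by simp
    qed
    have "lin_indpt (set (cols D))"
      using lin_depE[OF D _ dist] ker by blast
    then show "full_column_rank D" using lin_indpt_full_rank[OF D dist] fcr by simp
  qed
qed

section \<open>Existence and uniqueness of minimizers from the KKT system\<close>

section \<open>Minimizers and KKT points\<close>

lemma quadratic_form_add:
  fixes P :: "real mat"
  assumes P: "P \<in> carrier_mat n n" "P\<^sup>T = P" and x: "x \<in> carrier_vec n" "v \<in> carrier_vec n"
  shows "(x + v) \<bullet> (P *\<^sub>v (x + v)) = x \<bullet> (P *\<^sub>v x) + 2 * (v \<bullet> (P *\<^sub>v x)) + v \<bullet> (P *\<^sub>v v)"
proof -
  have "x \<bullet> (P *\<^sub>v v) = (P *\<^sub>v x) \<bullet> v"
    using transpose_vec_mult_scalar[OF P(1) x(2) x(1)] P(2) by simp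
  also have "\<dots> = v \<bullet> (P *\<^sub>v x)" using P x by (intro comm_scalar_prod[of _ n]) auto
  finally have sym: "x \<bullet> (P *\<^sub>v v) = v \<bullet> (P *\<^sub>v x)" .
  have "(x + v) \<bullet> (P *\<^sub>v (x + v)) = (x + v) \<bullet> (P *\<^sub>v x) + (x + v) \<bullet> (P *\<^sub>v v)"
    using P x by (simp add: mult_add_distrib_mat_vec[of _ n n] scalar_prod_add_distrib[of _ n])
  also have "\<dots> = (x \<bullet> (P *\<^sub>v x) + v \<bullet> (P *\<^sub>v x)) + (x \<bullet> (P *\<^sub>v v) + v \<bullet> (P *\<^sub>v v))"
    using P x by (simp add: add_scalar_prod_distrib[of _ n])
  finally show ?thesis using sym by simp
qed

text \<open>No square root of \<open>P\<close> is needed: with \<open>y = P v\<close>, the form at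
  \<open>v + t y\<close> is \<open>2 t s + t^2 c\<close>, where \<open>s\<close> is the squared
  length of \<open>y\<close>. Unless \<open>s = 0\<close>, a suitable negative \<open>t\<close>
  makes it negative.\<close>

lemma sym_psd_mat_form_eq_0:
  assumes P: "P \<in> carrier_mat n n" "sym_psd_mat P" and v: "v \<in> carrier_vec n"
    and 0: "v \<bullet> (P *\<^sub>v v) = 0"
  shows "P *\<^sub>v v = 0\<^sub>v n"
proof -
  define y where "y = P *\<^sub>v v"
  define s where "s = y \<bullet> y"
  define c where "c = y \<bullet> (P *\<^sub>v y)"
  have y: "y \<in> carrier_vec n" using P v unfolding y_def by auto
  have psd: "0 \<le> x \<bullet> (P *\<^sub>v x)" if "x \<in> carrier_vec n" for x
    using P that unfolding sym_psd_mat_def by auto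
  have c0: "c \<ge> 0" using psd[OF y] unfolding c_def .
  \<comment> \<open>The minimizing value would be \<open>- s / c\<close>; adding 1 keeps the
    denominator positive when \<open>c = 0\<close>. The form then equals
    \<open>- t^2 (c + 2)\<close>.\<close>
  define t where "t = - s / (c + 1)"
  have tc: "t * c = - s - t" using c0 unfolding t_def by (simp add: field_simps)
  have "0 \<le> (v + t \<cdot>\<^sub>v y) \<bullet> (P *\<^sub>v (v + t \<cdot>\<^sub>v y))" using psd v y by auto
  also have "\<dots> = 2 * (t * s) + t * (t * c)"
    using P v y 0 unfolding sym_psd_mat_def
    by (subst quadratic_form_add[of _ n]) (auto simp: mult_mat_vec[of _ n n] y_def[symmetric] s_def c_def)
  also have "\<dots> = t * (s - t)" unfolding tc by (simp add: algebra_simps)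
  also have "s = - t * (c + 1)" using tc by (simp add: algebra_simps)
  also have "t * (- t * (c + 1) - t) = - (t\<^sup>2 * (c + 2))"
    by (simp add: algebra_simps power2_eq_square)
  finally have "t\<^sup>2 * (c + 2) \<le> 0" by simp
  then have "t = 0" using c0 by (auto simp: mult_le_0_iff)
  then have "s = 0" using tc by simp
  then have "y = 0\<^sub>v (dim_vec y)" using scalar_prod_self_eq_0[of y] unfolding s_def by simp
  then show ?thesis using y unfolding y_def[symmetric] by (simp add: carrier_vecD)
qed

lemma qp_b_carrier [simp]: "qp_b Q \<in> carrier_vec (dim_con Q)"
  unfolding dim_con_def by (rule carrier_vec_dim_vec)

lemma qp_q_carrier [simp]: "qp_q Q \<in> carrier_vec (dim_dec Q)"
  unfolding dim_dec_def by (rule carrier_vec_dim_vec)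

lemma kkt_mat_carrier:
  assumes "is_open_qp Q"
  shows "kkt_mat Q \<in> carrier_mat (dim_dec Q + dim_con Q) (dim_dec Q + dim_con Q)"
  using assms unfolding is_open_qp_def kkt_mat_def by (intro four_block_carrier_mat) auto

lemma kkt_mat_mult_append:
  assumes "is_open_qp Q" "x \<in> carrier_vec (dim_dec Q)" "l \<in> carrier_vec (dim_con Q)"
  shows "kkt_mat Q *\<^sub>v (x @\<^sub>v l) = (qp_P Q *\<^sub>v x + (qp_A Q)\<^sup>T *\<^sub>v l) @\<^sub>v (qp_A Q *\<^sub>v x)"
proof -
  have "kkt_mat Q *\<^sub>v (x @\<^sub>v l) = (qp_P Q *\<^sub>v x + (qp_A Q)\<^sup>T *\<^sub>v l) @\<^sub>v
     (qp_A Q *\<^sub>v x + 0\<^sub>m (dim_con Q) (dim_con Q) *\<^sub>v l)"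
    unfolding kkt_mat_def using assms unfolding is_open_qp_def
    by (intro four_block_mat_mult_vec) auto
  moreover have "qp_A Q *\<^sub>v x + 0\<^sub>m (dim_con Q) (dim_con Q) *\<^sub>v l = qp_A Q *\<^sub>v x"
    using assms unfolding is_open_qp_def by (intro eq_vecI) auto
  ultimately show ?thesis by simp
qed

text \<open>The vector \<open>l\<close> is the multiplier. Stationarity and feasibility together
  form the linear system with matrix \<open>kkt_mat Q\<close> and right-hand side
  \<open>(- (q + N u), b - M u)\<close>.\<close>

definition kkt_point :: "open_qp \<Rightarrow> real vec \<Rightarrow> real vec \<Rightarrow> real vec \<Rightarrow> bool" where
  "kkt_point Q u x l \<longleftrightarrow> x \<in> carrier_vec (dim_dec Q) \<and> l \<in> carrier_vec (dim_con Q) \<and>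
     qp_P Q *\<^sub>v x + (qp_A Q)\<^sup>T *\<^sub>v l = - (qp_q Q + qp_N Q *\<^sub>v u) \<and>
     qp_A Q *\<^sub>v x + qp_M Q *\<^sub>v u = qp_b Q"

lemma kkt_point_exists:
  assumes Q: "is_open_qp Q" "invertible_mat (kkt_mat Q)" and u: "u \<in> carrier_vec (dim_in Q)"
  obtains x l where "kkt_point Q u x l"
proof -
  let ?n = "dim_dec Q" and ?p = "dim_con Q"
  let ?g = "- (qp_q Q + qp_N Q *\<^sub>v u)" and ?h = "qp_b Q - qp_M Q *\<^sub>v u"
  have M: "qp_M Q *\<^sub>v u \<in> carrier_vec ?p" "qp_b Q \<in> carrier_vec ?p"
    and N: "qp_N Q *\<^sub>v u \<in> carrier_vec ?n" "qp_q Q \<in> carrier_vec ?n"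
    using Q(1) u unfolding is_open_qp_def by auto
  then have gh: "?g @\<^sub>v ?h \<in> carrier_vec (?n + ?p)" by auto
  obtain z where z: "z \<in> carrier_vec (?n + ?p)" "kkt_mat Q *\<^sub>v z = ?g @\<^sub>v ?h"
    using invertible_mat_solution[OF kkt_mat_carrier[OF Q(1)] Q(2) gh] .
  define x l where "x = vec_first z ?n" and "l = vec_last z ?p"
  have x: "x \<in> carrier_vec ?n" and l: "l \<in> carrier_vec ?p" and zxl: "z = x @\<^sub>v l"
    using z(1) unfolding x_def l_def by auto
  have "(qp_P Q *\<^sub>v x + (qp_A Q)\<^sup>T *\<^sub>v l) @\<^sub>v (qp_A Q *\<^sub>v x) = ?g @\<^sub>v ?h"
    using z(2) kkt_mat_mult_append[OF Q(1) x l] zxl by simp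
  moreover have "qp_P Q *\<^sub>v x + (qp_A Q)\<^sup>T *\<^sub>v l \<in> carrier_vec ?n"
    using Q(1) x l unfolding is_open_qp_def by auto
  moreover have "?g \<in> carrier_vec ?n" using N by auto
  ultimately have "qp_P Q *\<^sub>v x + (qp_A Q)\<^sup>T *\<^sub>v l = ?g" "qp_A Q *\<^sub>v x = ?h"
    using append_vec_eq by metis+
  then have "kkt_point Q u x l" using x l vec_add_diff_cancel(2)[OF M(2,1)] unfolding kkt_point_def by simp
  then show ?thesis using that by blast
qed

text \<open>The first-order term vanishes: by stationarity it is minus the scalar product of
  \<open>A^T l\<close> with \<open>v\<close>, hence of \<open>l\<close> with \<open>A v = 0\<close>.
  Only the second-order term is left.\<close>

lemma qp_objective_add:
  assumes Q: "is_open_qp Q" and u: "u \<in> carrier_vec (dim_in Q)" and kkt: "kkt_point Q u x l"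
    and v: "v \<in> carrier_vec (dim_dec Q)" "qp_A Q *\<^sub>v v = 0\<^sub>v (dim_con Q)"
  shows "qp_objective Q u (x + v) = qp_objective Q u x + 1 / 2 * (v \<bullet> (qp_P Q *\<^sub>v v))"
proof -
  let ?n = "dim_dec Q" and ?p = "dim_con Q"
  let ?P = "qp_P Q" and ?A = "qp_A Q" and ?c = "qp_q Q + qp_N Q *\<^sub>v u"
  have P: "?P \<in> carrier_mat ?n ?n" "?P\<^sup>T = ?P" and A: "?A \<in> carrier_mat ?p ?n"
    and c: "?c \<in> carrier_vec ?n"
    using Q u unfolding is_open_qp_def sym_psd_mat_def by auto
  have x: "x \<in> carrier_vec ?n" and l: "l \<in> carrier_vec ?p"
    and st: "?P *\<^sub>v x + ?A\<^sup>T *\<^sub>v l = - ?c"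
    using kkt unfolding kkt_point_def by auto
  have "(?A\<^sup>T *\<^sub>v l) \<bullet> v = 0"
    using transpose_vec_mult_scalar[OF A v(1) l] v(2) l by simp
  moreover have "(?P *\<^sub>v x) \<bullet> v + (?A\<^sup>T *\<^sub>v l) \<bullet> v = - (?c \<bullet> v)"
    using st P A x l v c uminus_scalar_prod[OF c v(1)]
    by (subst add_scalar_prod_distrib[of _ ?n, symmetric]) auto
  moreover have "(?P *\<^sub>v x) \<bullet> v = v \<bullet> (?P *\<^sub>v x)"
    using P x v by (intro comm_scalar_prod[of _ ?n]) auto
  ultimately have "v \<bullet> (?P *\<^sub>v x) + ?c \<bullet> v = 0" by simp
  moreover have "?c \<bullet> (x + v) = ?c \<bullet> x + ?c \<bullet> v"
    using c x v by (simp add: scalar_prod_add_distrib[of _ ?n])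
  ultimately show ?thesis
    unfolding qp_objective_def using quadratic_form_add[OF P x v(1)] by (simp add: field_simps)
qed

text \<open>Semidefiniteness makes the KKT point a minimizer, and nonsingularity makes it the only
  one. The behavior is therefore the graph of a function defined for all inputs.\<close>

lemma qp_minimizer_iff_kkt_point:
  assumes Q: "is_open_qp Q" "invertible_mat (kkt_mat Q)" and u: "u \<in> carrier_vec (dim_in Q)"
    and kkt: "kkt_point Q u x l"
  shows "qp_minimizer Q u y \<longleftrightarrow> y = x"
proof -
  let ?n = "dim_dec Q" and ?p = "dim_con Q"
  let ?P = "qp_P Q" and ?A = "qp_A Q"
  have P: "?P \<in> carrier_mat ?n ?n" "sym_psd_mat ?P" and A: "?A \<in> carrier_mat ?p ?n"
    and M: "qp_M Q *\<^sub>v u \<in> carrier_vec ?p"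
    using Q u unfolding is_open_qp_def by auto
  have x: "x \<in> carrier_vec ?n" and feas: "qp_feasible Q u x"
    using kkt unfolding kkt_point_def qp_feasible_def by auto
  \<comment> \<open>Two feasible points for the same \<open>u\<close> differ by a kernel vector of
    \<open>A\<close>, so the second-order expansion at \<open>x\<close> covers every feasible
    \<open>y\<close>.\<close>
  have diff: "qp_objective Q u y = qp_objective Q u x + 1 / 2 * ((y - x) \<bullet> (?P *\<^sub>v (y - x)))"
    and diff_ker: "?A *\<^sub>v (y - x) = 0\<^sub>v ?p" if "qp_feasible Q u y" for y
  proof -
    have y: "y \<in> carrier_vec ?n" and e: "?A *\<^sub>v y + qp_M Q *\<^sub>v u = ?A *\<^sub>v x + qp_M Q *\<^sub>v u"
      using that feas unfolding qp_feasible_def by auto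
    have Ay: "?A *\<^sub>v y \<in> carrier_vec ?p" "?A *\<^sub>v x \<in> carrier_vec ?p" using A x y by auto
    have "?A *\<^sub>v y = ?A *\<^sub>v x"
    proof -
      have "?A *\<^sub>v y = (?A *\<^sub>v y + qp_M Q *\<^sub>v u) - qp_M Q *\<^sub>v u" using vec_add_diff_cancel(1)[OF Ay(1) M] by simp
      also have "\<dots> = ?A *\<^sub>v x" unfolding e using vec_add_diff_cancel(1)[OF Ay(2) M] .
      finally show ?thesis .
    qed
    then show k: "?A *\<^sub>v (y - x) = 0\<^sub>v ?p"
      using A x y by (simp add: mult_minus_distrib_mat_vec[of _ ?p ?n])
    have "x + (y - x) = y" using x y by auto
    then show "qp_objective Q u y = qp_objective Q u x + 1 / 2 * ((y - x) \<bullet> (?P *\<^sub>v (y - x)))"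
      using qp_objective_add[OF Q(1) u kkt _ k] x y by auto
  qed
  have psd: "0 \<le> v \<bullet> (?P *\<^sub>v v)" if "v \<in> carrier_vec ?n" for v
    using P that unfolding sym_psd_mat_def by auto
  have feas_carrier: "y \<in> carrier_vec ?n" if "qp_feasible Q u y" for y
    using that unfolding qp_feasible_def by simp
  show ?thesis
  proof
    assume "y = x"
    have "qp_objective Q u x \<le> qp_objective Q u z" if "qp_feasible Q u z" for z
      using diff[OF that] psd[of "z - x"] feas_carrier[OF that] x by auto
    then show "qp_minimizer Q u y"
      using feas \<open>y = x\<close> unfolding qp_minimizer_def is_arg_min_def by (auto simp: not_less)
  next
    assume "qp_minimizer Q u y"
    then have fy: "qp_feasible Q u y" and le: "qp_objective Q u y \<le> qp_objective Q u x"
      using feas unfolding qp_minimizer_def is_arg_min_def by (auto simp: not_less)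
    have y: "y \<in> carrier_vec ?n" using feas_carrier[OF fy] .
    let ?v = "y - x"
    have v: "?v \<in> carrier_vec ?n" using x y by auto
    have "?v \<bullet> (?P *\<^sub>v ?v) = 0" using le diff[OF fy] psd[OF v] by simp
    then have "?P *\<^sub>v ?v = 0\<^sub>v ?n" using sym_psd_mat_form_eq_0[OF P v] by simp
    \<comment> \<open>Both \<open>P v\<close> and \<open>A v\<close> vanish, so \<open>v\<close>
      padded by a zero multiplier lies in the kernel of the KKT matrix.\<close>
    then have "kkt_mat Q *\<^sub>v (?v @\<^sub>v 0\<^sub>v ?p) = 0\<^sub>v (?n + ?p)"
      using kkt_mat_mult_append[OF Q(1) v, of "0\<^sub>v ?p"] diff_ker[OF fy] A by auto
    then have "?v @\<^sub>v 0\<^sub>v ?p = 0\<^sub>v (?n + ?p)"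
      using invertible_mat_iff_trivial_kernel[OF kkt_mat_carrier[OF Q(1)]] Q(2) v by auto
    then have "?v @\<^sub>v 0\<^sub>v ?p = 0\<^sub>v ?n @\<^sub>v 0\<^sub>v ?p" by auto
    then have "?v = 0\<^sub>v ?n" using append_vec_eq[OF v] by auto
    then show "y = x" using vec_add_diff_cancel(2)[OF y x] x by simp
  qed
qed

section \<open>Stacked equations and selected components\<close>

lemma list_of_vec_mult_mat_vec: "list_of_vec (A *\<^sub>v w) = map (\<lambda>r. r \<bullet> w) (rows A)"
  by (rule nth_equalityI) (auto simp: list_of_vec_index)

text \<open>On lists of entries this is the fact that \<open>map\<close> commutes with
  \<open>concat\<close>. The common width lets \<open>mat_of_rows\<close> return the given rows
  unchanged.\<close>

lemma stack_mat_mult_vec: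
  assumes "\<And>A. A \<in> set As \<Longrightarrow> dim_col A = n"
  shows "stack_mat n As *\<^sub>v w = stack_vec (map (\<lambda>A. A *\<^sub>v w) As)"
proof -
  let ?rs = "concat (map rows As)"
  have rs: "\<forall>r \<in> set ?rs. r \<in> carrier_vec n"
    using assms rows_carrier by (auto simp: subset_iff)
  have "list_of_vec (mat_of_rows n ?rs *\<^sub>v w) = map (\<lambda>r. r \<bullet> w) ?rs"
    using rs by (subst list_of_vec_mult_mat_vec, subst rows_mat_of_rows) auto
  also have "\<dots> = concat (map (\<lambda>A. list_of_vec (A *\<^sub>v w)) As)"
    by (simp add: map_concat list_of_vec_mult_mat_vec comp_def)
  finally have eq: "list_of_vec (mat_of_rows n ?rs *\<^sub>v w) = concat (map (\<lambda>A. list_of_vec (A *\<^sub>v w)) As)" .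
  show ?thesis
    unfolding stack_mat_def stack_vec_def map_map comp_def eq[symmetric] by (simp only: vec_list)
qed

lemma stack_mat_carrier: "stack_mat n As \<in> carrier_mat (sum_list (map dim_row As)) n"
  unfolding stack_mat_def by (rule carrier_matI) (simp_all add: length_concat comp_def)

lemma dim_stack_vec: "dim_vec (stack_vec vs) = sum_list (map dim_vec vs)"
  unfolding stack_vec_def by (simp add: length_concat comp_def)

text \<open>Concatenation is injective once the block lengths agree, so a stacked equation can be
  split into its blocks.\<close>

lemma stack_vec_eq_iff:
  assumes "map dim_vec xs = map dim_vec ys"
  shows "stack_vec xs = stack_vec ys \<longleftrightarrow> xs = ys"
proof
  assume "stack_vec xs = stack_vec ys"
  then have "concat (map list_of_vec xs) = concat (map list_of_vec ys)"
    unfolding stack_vec_def by (metis list_vec)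
  moreover have len: "length xs = length ys" using assms by (metis length_map)
  moreover have "dim_vec (xs ! i) = dim_vec (ys ! i)" if "i < length ys" for i
    using arg_cong[OF assms, of "\<lambda>l. l ! i"] len that by simp
  ultimately have "map list_of_vec xs = map list_of_vec ys"
    by (intro concat_injective) (auto simp: in_set_zip)
  then have "map vec_of_list (map list_of_vec xs) = map vec_of_list (map list_of_vec ys)" by simp
  then show "xs = ys" by (simp add: comp_def vec_list)
qed simp

text \<open>Block by block, associativity turns the equation for
  \<open>Ds i * proj_mat k Q i\<close> into membership of the projected signal in
  \<open>behavior (Q i)\<close>. All three statements start from this description.\<close>

lemma interconnected_behavior_eq_affine:
  fixes k :: nat
  assumes D0: "D0 \<in> carrier_mat (dim_vec d0) (dim_total k Q)"
    and Ds: "\<And>i. i < k \<Longrightarrow> Ds i \<in> carrier_mat (dim_vec (ds i)) (dim_sig (Q i))"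
    and Bs: "\<And>i. i < k \<Longrightarrow>
               behavior (Q i) = {v \<in> carrier_vec (dim_sig (Q i)). Ds i *\<^sub>v v = ds i}"
    and D: "D = stack_mat (dim_total k Q) (D0 # map (\<lambda>i. Ds i * proj_mat k Q i) [0..<k])"
    and d: "d = stack_vec (d0 # map ds [0..<k])"
  shows "interconnected_behavior k Q {w \<in> carrier_vec (dim_total k Q). D0 *\<^sub>v w = d0} =
           {w \<in> carrier_vec (dim_total k Q). D *\<^sub>v w = d}"
    and "D \<in> carrier_mat (dim_vec d) (dim_total k Q)"
proof -
  let ?n = "dim_total k Q"
  let ?As = "D0 # map (\<lambda>i. Ds i * proj_mat k Q i) [0..<k]"
  have proj: "proj_mat k Q i \<in> carrier_mat (dim_sig (Q i)) ?n" for i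
    unfolding proj_mat_def by auto
  have cols: "\<And>A. A \<in> set ?As \<Longrightarrow> dim_col A = ?n"
    using D0 carrier_matD(2)[OF proj] by auto
  have Drow: "dim_row D0 = dim_vec d0" "\<And>i. i < k \<Longrightarrow> dim_row (Ds i) = dim_vec (ds i)"
    using D0 Ds by (auto dest: carrier_matD)
  have "map dim_row ?As = map dim_vec (d0 # map ds [0..<k])"
    using Drow by simp
  then show "D \<in> carrier_mat (dim_vec d) ?n"
    using stack_mat_carrier[of ?n ?As] unfolding D d dim_stack_vec by metis
  have "D *\<^sub>v w = d \<longleftrightarrow> D0 *\<^sub>v w = d0 \<and> (\<forall>i<k. proj_mat k Q i *\<^sub>v w \<in> behavior (Q i))"
    if w: "w \<in> carrier_vec ?n" for w
  proof -
    have "D *\<^sub>v w = d \<longleftrightarrow> map (\<lambda>A. A *\<^sub>v w) ?As = d0 # map ds [0..<k]"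
    proof -
      have "map dim_vec (map (\<lambda>A. A *\<^sub>v w) ?As) = map dim_vec (d0 # map ds [0..<k])"
        using Drow by simp
      from stack_vec_eq_iff[OF this] show ?thesis
        unfolding D d using stack_mat_mult_vec[of ?As ?n w, OF cols] by simp
    qed
    also have "\<dots> \<longleftrightarrow> D0 *\<^sub>v w = d0 \<and> (\<forall>i<k. (Ds i * proj_mat k Q i) *\<^sub>v w = ds i)"
      by auto
    also have "\<dots> \<longleftrightarrow> D0 *\<^sub>v w = d0 \<and> (\<forall>i<k. proj_mat k Q i *\<^sub>v w \<in> behavior (Q i))"
    proof -
      have "(Ds i * proj_mat k Q i) *\<^sub>v w = ds i \<longleftrightarrow> proj_mat k Q i *\<^sub>v w \<in> behavior (Q i)"
        if "i < k" for i
        using Bs[OF that] assoc_mult_mat_vec[OF Ds[OF that] proj w]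
          mult_mat_vec_carrier[OF proj w] by auto
      then show ?thesis by auto
    qed
    finally show ?thesis .
  qed
  then show "interconnected_behavior k Q {w \<in> carrier_vec ?n. D0 *\<^sub>v w = d0} =
           {w \<in> carrier_vec ?n. D *\<^sub>v w = d}"
    unfolding interconnected_behavior_def by auto
qed

section \<open>Selected components and column partitions\<close>

lemma select_vec_carrier [simp]: "select_vec w js \<in> carrier_vec (length js)"
  by (rule carrier_vecI) (simp add: select_vec_def del: vec_of_list_map)

lemma dim_select_vec [simp]: "dim_vec (select_vec w js) = length js"
  by (rule carrier_vecD[OF select_vec_carrier])

lemma select_vec_index [simp]: "i < length js \<Longrightarrow> select_vec w js $ i = w $ (js ! i)"
  unfolding select_vec_def by (simp add: vec_of_list_index del: vec_of_list_map)

lemma select_vec_append: "select_vec w (is @ js) = select_vec w is @\<^sub>v select_vec w js"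
  by (rule eq_vecI) (simp_all add: nth_append)

lemma select_cols_carrier [simp]: "select_cols D js \<in> carrier_mat (dim_row D) (length js)"
  by (rule carrier_matI) (simp_all add: select_cols_def)

lemma dim_select_cols [simp]:
  "dim_row (select_cols D js) = dim_row D" "dim_col (select_cols D js) = length js"
  by (rule carrier_matD[OF select_cols_carrier])+

lemma select_cols_index:
  assumes "i < dim_row D" "t < length js" "js ! t < dim_col D"
  shows "select_cols D js $$ (i, t) = D $$ (i, js ! t)"
  using assms unfolding select_cols_def by (simp add: mat_of_cols_index)

lemma select_cols_mult_index:
  assumes D: "D \<in> carrier_mat m n" and js: "distinct js" "set js \<subseteq> {..<n}" and i: "i < m"
  shows "(select_cols D js *\<^sub>v select_vec w js) $ i = (\<Sum>j \<in> set js. D $$ (i, j) * w $ j)"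
proof -
  have row: "i < dim_row D" and col: "js ! t < dim_col D" if "t < length js" for t
    using carrier_matD[OF D] i subsetD[OF js(2) nth_mem[OF that]] by simp_all
  have "(select_cols D js *\<^sub>v select_vec w js) $ i = row (select_cols D js) i \<bullet> select_vec w js"
    using carrier_matD[OF D] i by (intro index_mult_mat_vec) simp
  also have "\<dots> = (\<Sum>t \<in> {0..<length js}. row (select_cols D js) i $ t * select_vec w js $ t)"
    unfolding scalar_prod_def by simp
  also have "\<dots> = (\<Sum>t \<in> {..<length js}. D $$ (i, js ! t) * w $ (js ! t))"
    unfolding atLeast0LessThan
    by (rule sum.cong) (simp_all add: row col select_cols_index)
  \<comment> \<open>Distinctness makes positions in \<open>js\<close> correspond bijectively to
    indices, so the order of the block no longer matters.\<close>
  also have "\<dots> = (\<Sum>j \<in> set js. D $$ (i, j) * w $ j)"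
  proof -
    have "bij_betw ((!) js) {..<length js} (set js)" using js(1) by (intro bij_betw_nth) auto
    from sum.reindex_bij_betw[OF this, where g = "\<lambda>j. D $$ (i, j) * w $ j"] show ?thesis .
  qed
  finally show ?thesis .
qed

lemma mult_mat_vec_partition:
  fixes D :: "'a :: comm_ring_1 mat"
  assumes part: "index_partition n is js" and D: "D \<in> carrier_mat m n" and w: "w \<in> carrier_vec n"
  shows "D *\<^sub>v w = select_cols D is *\<^sub>v select_vec w is + select_cols D js *\<^sub>v select_vec w js"
proof (rule eq_vecI)
  have row: "dim_row D = m" using D by simp
  show "dim_vec (D *\<^sub>v w) = dim_vec (select_cols D is *\<^sub>v select_vec w is + select_cols D js *\<^sub>v select_vec w js)"
    using row by simp
  have p: "distinct is" "distinct js" "set is \<inter> set js = {}" "set is \<union> set js = {..<n}"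
    using part unfolding index_partition_def by auto
  fix i assume "i < dim_vec (select_cols D is *\<^sub>v select_vec w is + select_cols D js *\<^sub>v select_vec w js)"
  then have i: "i < m" using row by simp
  have "(D *\<^sub>v w) $ i = (\<Sum>j \<in> {..<n}. D $$ (i, j) * w $ j)"
    using D w i by (auto simp: scalar_prod_def atLeast0LessThan intro!: sum.cong)
  also have "\<dots> = (\<Sum>j \<in> set is. D $$ (i, j) * w $ j) + (\<Sum>j \<in> set js. D $$ (i, j) * w $ j)"
    unfolding p(4)[symmetric] using p(3) by (intro sum.union_disjoint) auto
  also have "(\<Sum>j \<in> set is. D $$ (i, j) * w $ j) = (select_cols D is *\<^sub>v select_vec w is) $ i"
    using p D i by (subst select_cols_mult_index[of D m n]) auto
  also have "(\<Sum>j \<in> set js. D $$ (i, j) * w $ j) = (select_cols D js *\<^sub>v select_vec w js) $ i"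
    using p D i by (subst select_cols_mult_index[of D m n]) auto
  finally show "(D *\<^sub>v w) $ i = (select_cols D is *\<^sub>v select_vec w is + select_cols D js *\<^sub>v select_vec w js) $ i"
    using i row by (simp del: index_mult_mat_vec)
qed

lemma select_vec_surj:
  fixes u x :: "'a :: zero vec"
  assumes part: "index_partition n is js"
    and u: "u \<in> carrier_vec (length is)" and x: "x \<in> carrier_vec (length js)"
  obtains w where "w \<in> carrier_vec n" "select_vec w is = u" "select_vec w js = x"
proof -
  let ?ks = "is @ js" and ?y = "list_of_vec (u @\<^sub>v x)"
  \<comment> \<open>Entry \<open>j\<close> is looked up among the pairs of indices and prescribed
    values. The two blocks cover all indices below \<open>n\<close>, so \<open>the\<close> is only
    applied to successful lookups.\<close>
  define w where "w = vec n (\<lambda>j. the (map_of (zip ?ks ?y) j))"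
  have len: "length ?y = length ?ks" using u x by simp
  have ks: "distinct ?ks" "set ?ks = {..<n}" using part unfolding index_partition_def by auto
  have "select_vec w ?ks = u @\<^sub>v x"
  proof (rule eq_vecI)
    show dim: "dim_vec (select_vec w ?ks) = dim_vec (u @\<^sub>v x)"
      using u x by simp
    fix i assume "i < dim_vec (u @\<^sub>v x)"
    then have i: "i < length ?ks" using u x by simp
    then have "?ks ! i < n" using ks(2) by (metis lessThan_iff nth_mem)
    then have "select_vec w ?ks $ i = the (map_of (zip ?ks ?y) (?ks ! i))"
      by (simp only: select_vec_index[OF i] w_def index_vec)
    also have "\<dots> = ?y ! i" using map_of_zip_nth[of ?ks ?y i] len ks(1) i by simp
    finally show "select_vec w ?ks $ i = (u @\<^sub>v x) $ i"
      by (simp only: list_of_vec_index)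
  qed
  then have "select_vec w is = u \<and> select_vec w js = x"
    unfolding select_vec_append using append_vec_eq[OF select_vec_carrier u] by simp
  moreover have "w \<in> carrier_vec n" unfolding w_def by simp
  ultimately show ?thesis using that by blast
qed

text \<open>Reordering the components as inputs followed by outputs loses nothing, since every pair
  \<open>(u, x)\<close> comes from some \<open>w\<close>. Statement (i) thus becomes a question
  about the relation between \<open>u\<close> and \<open>x\<close>.\<close>

lemma select_image_affine:
  fixes D :: "'a :: comm_ring_1 mat"
  assumes part: "index_partition n is js" and D: "D \<in> carrier_mat m n"
  shows "(\<lambda>w. select_vec w is @\<^sub>v select_vec w js) ` {w \<in> carrier_vec n. D *\<^sub>v w = d} =
    {u @\<^sub>v x | u x. u \<in> carrier_vec (length is) \<and> x \<in> carrier_vec (length js) \<and>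
       select_cols D is *\<^sub>v u + select_cols D js *\<^sub>v x = d}" (is "?l = ?r")
proof
  show "?l \<subseteq> ?r"
  proof
    fix y assume "y \<in> ?l"
    then obtain w where w: "w \<in> carrier_vec n" "D *\<^sub>v w = d"
      and y: "y = select_vec w is @\<^sub>v select_vec w js" by blast
    have "select_cols D is *\<^sub>v select_vec w is + select_cols D js *\<^sub>v select_vec w js = d"
      using mult_mat_vec_partition[OF part D w(1)] w(2) by simp
    then show "y \<in> ?r" unfolding y using select_vec_carrier[of w] by blast
  qed
  show "?r \<subseteq> ?l"
  proof
    fix y assume "y \<in> ?r"
    then obtain u x where ux: "u \<in> carrier_vec (length is)" "x \<in> carrier_vec (length js)"
      "select_cols D is *\<^sub>v u + select_cols D js *\<^sub>v x = d" "y = u @\<^sub>v x" by blast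
    obtain w where "w \<in> carrier_vec n" "select_vec w is = u" "select_vec w js = x"
      using select_vec_surj[OF part ux(1,2)] .
    then show "y \<in> ?l" using mult_mat_vec_partition[OF part D, of w] ux by auto
  qed
qed

section \<open>Affine relations as behaviors of quadratic programs: statement (i)\<close>

section \<open>Interconnected behaviors\<close>

text \<open>With the length of the first block fixed, a concatenation determines both of its parts,
  so the given \<open>u\<close> and \<open>x\<close> are the only ones to test.\<close>

lemma append_vec_mem_graph_iff:
  assumes u: "u \<in> carrier_vec p"
  shows "u @\<^sub>v x \<in> {u @\<^sub>v x | u x. u \<in> carrier_vec p \<and> H u x} \<longleftrightarrow> H u x"
proof
  assume "u @\<^sub>v x \<in> {u @\<^sub>v x | u x. u \<in> carrier_vec p \<and> H u x}"
  then obtain u' x' where e: "u @\<^sub>v x = u' @\<^sub>v x'" and u': "u' \<in> carrier_vec p" and H: "H u' x'"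
    by blast
  have "u = u' \<and> x = x'" using e append_vec_eq[OF u u'] by simp
  then show "H u x" using H by simp
qed (use u in blast)

text \<open>Unique solvability for every input carries all the information: the input zero yields
  nonemptiness and the rank, and comparing another input with zero yields the image
  condition.\<close>

lemma affine_qp_behavior_conditions:
  fixes F G :: "real mat"
  assumes F: "F \<in> carrier_mat m p" and G: "G \<in> carrier_mat m q" and d: "d \<in> carrier_vec m"
    and S: "S = {u @\<^sub>v x | u x. u \<in> carrier_vec p \<and> x \<in> carrier_vec q \<and> F *\<^sub>v u + G *\<^sub>v x = d}"
    and Q: "is_open_qp Q" "invertible_mat (kkt_mat Q)"
    and dims: "dim_in Q = p" "dim_dec Q = q" and beh: "behavior Q = S"
  shows "S \<noteq> {} \<and> full_column_rank G \<and> mat_image F \<subseteq> mat_image G"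
proof -
  have sol: "\<exists>x \<in> carrier_vec q. \<forall>y \<in> carrier_vec q. F *\<^sub>v u + G *\<^sub>v y = d \<longleftrightarrow> y = x"
    if u: "u \<in> carrier_vec p" for u
  proof -
    have u': "u \<in> carrier_vec (dim_in Q)" using u dims by simp
    obtain x l where kkt: "kkt_point Q u x l" using kkt_point_exists[OF Q u'] .
    have "F *\<^sub>v u + G *\<^sub>v y = d \<longleftrightarrow> y = x" if y: "y \<in> carrier_vec q" for y
    proof -
      have "F *\<^sub>v u + G *\<^sub>v y = d \<longleftrightarrow> u @\<^sub>v y \<in> S"
        using append_vec_mem_graph_iff[OF u, of y "\<lambda>u x. x \<in> carrier_vec q \<and> F *\<^sub>v u + G *\<^sub>v x = d"] y
        unfolding S by simp
      also have "\<dots> \<longleftrightarrow> qp_minimizer Q u y"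
        using append_vec_mem_graph_iff[OF u, of y "qp_minimizer Q"]
        unfolding beh[symmetric] behavior_def dims by simp
      also have "\<dots> \<longleftrightarrow> y = x" using qp_minimizer_iff_kkt_point[OF Q u' kkt] .
      finally show ?thesis .
    qed
    moreover have "x \<in> carrier_vec q" using kkt dims unfolding kkt_point_def by simp
    ultimately show ?thesis by blast
  qed
  obtain x0 where x0: "x0 \<in> carrier_vec q" "\<And>y. y \<in> carrier_vec q \<Longrightarrow> F *\<^sub>v 0\<^sub>v p + G *\<^sub>v y = d \<longleftrightarrow> y = x0"
    using sol[of "0\<^sub>v p"] by auto
  have Gx0: "G *\<^sub>v y = d \<longleftrightarrow> y = x0" if "y \<in> carrier_vec q" for y
  proof -
    have "F *\<^sub>v 0\<^sub>v p + G *\<^sub>v y = G *\<^sub>v y" using F G that by (intro eq_vecI) auto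
    then show ?thesis using x0(2)[OF that] by simp
  qed
  have "0\<^sub>v p @\<^sub>v x0 \<in> S"
    using append_vec_mem_graph_iff[of "0\<^sub>v p" p x0 "\<lambda>u x. x \<in> carrier_vec q \<and> F *\<^sub>v u + G *\<^sub>v x = d"] x0
    unfolding S by simp
  moreover have "full_column_rank G"
    unfolding full_column_rank_iff_trivial_kernel[OF G]
  proof (intro ballI impI)
    fix v assume v: "v \<in> carrier_vec q" "G *\<^sub>v v = 0\<^sub>v m"
    \<comment> \<open>A kernel vector added to \<open>x0\<close> gives another solution for input
      zero, which must again be \<open>x0\<close>.\<close>
    have "G *\<^sub>v (v + x0) = d"
      using v x0(1) G d Gx0[OF x0(1)] by (simp add: mult_add_distrib_mat_vec[of _ m q])
    then have "v + x0 = x0" using Gx0 v x0(1) by simp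
    then show "v = 0\<^sub>v q" using vec_add_diff_cancel(1)[OF v(1) x0(1)] x0(1) by simp
  qed
  moreover have "mat_image F \<subseteq> mat_image G"
  proof
    fix y assume "y \<in> mat_image F"
    then obtain u where u: "u \<in> carrier_vec p" "y = F *\<^sub>v u" using F unfolding mat_image_def by auto
    obtain x where x: "x \<in> carrier_vec q" "F *\<^sub>v u + G *\<^sub>v x = d" using sol[OF u(1)] by blast
    \<comment> \<open>Since \<open>G x0 = d\<close>, subtracting the solution \<open>x\<close> for
      input \<open>u\<close> leaves \<open>F u = G (x0 - x)\<close>.\<close>
    have "G *\<^sub>v (x0 - x) = (F *\<^sub>v u + G *\<^sub>v x) - G *\<^sub>v x"
      using x G x0(1) Gx0[OF x0(1)] by (simp add: mult_minus_distrib_mat_vec[of _ m q])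
    also have "\<dots> = y" using vec_add_diff_cancel(1)[of "F *\<^sub>v u" m "G *\<^sub>v x"] F G u x by auto
    finally show "y \<in> mat_image G" using x x0(1) G unfolding mat_image_def by (auto simp: image_iff intro!: bexI[of _ "x0 - x"])
  qed
  ultimately show "S \<noteq> {} \<and> full_column_rank G \<and> mat_image F \<subseteq> mat_image G" by blast
qed

text \<open>Every input admits an exact solution, so the least residual is zero and the minimizers
  are the exact solutions. Injectivity of \<open>G\<close> makes the KKT matrix \<open>G^T G\<close>
  nonsingular.\<close>

lemma least_squares_qp_behavior:
  fixes F G :: "real mat"
  assumes F: "F \<in> carrier_mat m p" and G: "G \<in> carrier_mat m q" and d: "d \<in> carrier_vec m"
    and S: "S = {u @\<^sub>v x | u x. u \<in> carrier_vec p \<and> x \<in> carrier_vec q \<and> F *\<^sub>v u + G *\<^sub>v x = d}"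
    and ne: "S \<noteq> {}" and rank: "full_column_rank G" and img: "mat_image F \<subseteq> mat_image G"
  shows "\<exists>Q. is_open_qp Q \<and> dim_in Q = p \<and> dim_dec Q = q \<and> invertible_mat (kkt_mat Q) \<and> behavior Q = S"
proof -
  have ker: "\<forall>v \<in> carrier_vec q. G *\<^sub>v v = 0\<^sub>v m \<longrightarrow> v = 0\<^sub>v q"
    using rank full_column_rank_iff_trivial_kernel[OF G] by simp
  obtain u0 x0 where 0: "u0 \<in> carrier_vec p" "x0 \<in> carrier_vec q" "F *\<^sub>v u0 + G *\<^sub>v x0 = d"
    using ne unfolding S by blast
  \<comment> \<open>One solution \<open>(u0, x0)\<close> suffices: if
    \<open>F (u - u0) = G z\<close>, then \<open>x0 - z\<close> solves the equation for
    \<open>u\<close>.\<close>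
  have sol: "\<exists>x \<in> carrier_vec q. F *\<^sub>v u + G *\<^sub>v x = d" if u: "u \<in> carrier_vec p" for u
  proof -
    have "F *\<^sub>v (u - u0) \<in> mat_image F" using F u 0 unfolding mat_image_def by auto
    then obtain z where z: "z \<in> carrier_vec q" "F *\<^sub>v (u - u0) = G *\<^sub>v z"
      using img G unfolding mat_image_def by auto
    have "F *\<^sub>v u - F *\<^sub>v u0 = G *\<^sub>v z"
      using z F u 0 by (simp add: mult_minus_distrib_mat_vec[of _ m p])
    moreover have "F *\<^sub>v u + (G *\<^sub>v x0 - (F *\<^sub>v u - F *\<^sub>v u0)) = F *\<^sub>v u0 + G *\<^sub>v x0"
      using F G u 0 by (intro eq_vecI) auto
    ultimately have "F *\<^sub>v u + G *\<^sub>v (x0 - z) = d"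
      using 0 z G by (simp add: mult_minus_distrib_mat_vec[of _ m q])
    then show ?thesis using 0(2) z(1) by (intro bexI[of _ "x0 - z"]) auto
  qed
  \<comment> \<open>Expanding \<open>|F u + G x - d|^2 / 2\<close> gives these data, up to a term
    independent of \<open>x\<close>. Matrices with no rows encode the absence of
    constraints.\<close>
  define Q where "Q = \<lparr>qp_P = G\<^sup>T * G, qp_q = - (G\<^sup>T *\<^sub>v d), qp_N = G\<^sup>T * F,
    qp_A = 0\<^sub>m 0 q, qp_M = 0\<^sub>m 0 p, qp_b = 0\<^sub>v 0\<rparr>"
  have dims: "dim_in Q = p" "dim_dec Q = q" "dim_con Q = 0"
    using F G unfolding Q_def dim_in_def dim_dec_def dim_con_def by auto
  have GT: "G\<^sup>T \<in> carrier_mat q m" using G by simp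
  have form: "x \<bullet> ((G\<^sup>T * G) *\<^sub>v x) = (G *\<^sub>v x) \<bullet> (G *\<^sub>v x)" if x: "x \<in> carrier_vec q" for x
  proof -
    have "x \<bullet> ((G\<^sup>T * G) *\<^sub>v x) = x \<bullet> (G\<^sup>T *\<^sub>v (G *\<^sub>v x))" using GT G x by simp
    also have "\<dots> = (G\<^sup>T *\<^sub>v (G *\<^sub>v x)) \<bullet> x" using G x by (intro comm_scalar_prod[of _ q]) auto
    also have "\<dots> = (G *\<^sub>v x) \<bullet> (G *\<^sub>v x)" using transpose_vec_mult_scalar[OF G x, of "G *\<^sub>v x"] G x by simp
    finally show ?thesis .
  qed
  have "(G\<^sup>T * G)\<^sup>T = G\<^sup>T * G" using transpose_mult[OF GT G] by simp
  then have "sym_psd_mat (G\<^sup>T * G)"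
    using form G scalar_prod_self_nonneg unfolding sym_psd_mat_def by auto
  then have Qqp: "is_open_qp Q"
    using F G dims unfolding is_open_qp_def by (simp add: Q_def)
  have K: "kkt_mat Q = G\<^sup>T * G"
    unfolding kkt_mat_def dims using G by (intro eq_matI) (auto simp: Q_def)
  have Kinv: "invertible_mat (kkt_mat Q)"
    unfolding K invertible_mat_iff_trivial_kernel[OF mult_carrier_mat[OF GT G]]
  proof (intro ballI impI)
    fix v assume v: "v \<in> carrier_vec q" "G\<^sup>T * G *\<^sub>v v = 0\<^sub>v q"
    then have "(G *\<^sub>v v) \<bullet> (G *\<^sub>v v) = 0" using form[OF v(1)] by simp
    then have "G *\<^sub>v v = 0\<^sub>v m" using scalar_prod_self_eq_0[of "G *\<^sub>v v"] G by simp
    then show "v = 0\<^sub>v q" using ker v by blast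
  qed
  have "qp_minimizer Q u y \<longleftrightarrow> y \<in> carrier_vec q \<and> F *\<^sub>v u + G *\<^sub>v y = d"
    if u: "u \<in> carrier_vec p" for u y
  proof -
    obtain x where x: "x \<in> carrier_vec q" "F *\<^sub>v u + G *\<^sub>v x = d" using sol[OF u] by blast
    have Fu: "F *\<^sub>v u \<in> carrier_vec m" and Gx: "G *\<^sub>v x \<in> carrier_vec m" using F G u x by auto
    \<comment> \<open>Multiplying the exact equation by the transpose of \<open>G\<close> gives the
      normal equations, so \<open>x\<close> is a KKT point with empty multiplier.\<close>
    have "G\<^sup>T *\<^sub>v d = (G\<^sup>T * F) *\<^sub>v u + (G\<^sup>T * G) *\<^sub>v x"
      unfolding x(2)[symmetric] using GT F G u x(1) Fu Gx
      by (simp add: mult_add_distrib_mat_vec[of _ q m])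
    then have "(G\<^sup>T * G) *\<^sub>v x + (0\<^sub>m 0 q)\<^sup>T *\<^sub>v 0\<^sub>v 0 = - (- (G\<^sup>T *\<^sub>v d) + (G\<^sup>T * F) *\<^sub>v u)"
      using F G u x by (intro eq_vecI) auto
    moreover have "0\<^sub>m 0 q *\<^sub>v x + 0\<^sub>m 0 p *\<^sub>v u = 0\<^sub>v 0" by (intro eq_vecI) auto
    ultimately have kkt: "kkt_point Q u x (0\<^sub>v 0)"
      unfolding kkt_point_def dims using x by (simp add: Q_def)
    have "y = x" if y: "y \<in> carrier_vec q" "F *\<^sub>v u + G *\<^sub>v y = d"
    proof -
      have Gy: "G *\<^sub>v y \<in> carrier_vec m" using G y by simp
      have "G *\<^sub>v (y - x) = G *\<^sub>v y - G *\<^sub>v x"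
        using G x y by (simp add: mult_minus_distrib_mat_vec[of _ m q])
      also have "\<dots> = (F *\<^sub>v u + G *\<^sub>v y) - (F *\<^sub>v u + G *\<^sub>v x)"
        using Fu Gx Gy by (intro eq_vecI) auto
      also have "\<dots> = 0\<^sub>v m" using x y d by simp
      finally have "y - x = 0\<^sub>v q" using ker x y by auto
      then show ?thesis using vec_add_diff_cancel(2)[OF y(1) x(1)] x(1) by simp
    qed
    then show ?thesis
      using x qp_minimizer_iff_kkt_point[OF Qqp Kinv _ kkt] u dims by auto
  qed
  then have "behavior Q = S" unfolding behavior_def S dims by blast
  then show "\<exists>Q. is_open_qp Q \<and> dim_in Q = p \<and> dim_dec Q = q \<and> invertible_mat (kkt_mat Q) \<and> behavior Q = S"
    using Qqp Kinv dims by blast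
qed

lemma affine_set_is_qp_behavior_iff:
  fixes F G :: "real mat"
  assumes F: "F \<in> carrier_mat m p" and G: "G \<in> carrier_mat m q" and d: "d \<in> carrier_vec m"
    and S: "S = {u @\<^sub>v x | u x. u \<in> carrier_vec p \<and> x \<in> carrier_vec q \<and> F *\<^sub>v u + G *\<^sub>v x = d}"
  shows "(\<exists>Q. is_open_qp Q \<and> dim_in Q = p \<and> dim_dec Q = q \<and> invertible_mat (kkt_mat Q) \<and> behavior Q = S)
    \<longleftrightarrow> S \<noteq> {} \<and> full_column_rank G \<and> mat_image F \<subseteq> mat_image G"
  using affine_qp_behavior_conditions[OF F G d S] least_squares_qp_behavior[OF F G d S] by metis

section \<open>Uniqueness of solutions and loop maps: statements (ii) and (iii)\<close>

lemma is_singleton_solution_set_iff: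
  fixes D :: "real mat"
  assumes D: "D \<in> carrier_mat m n"
  shows "is_singleton {w \<in> carrier_vec n. D *\<^sub>v w = d} \<longleftrightarrow>
    (\<exists>w \<in> carrier_vec n. D *\<^sub>v w = d) \<and> full_column_rank D"
  unfolding full_column_rank_iff_trivial_kernel[OF D]
proof (intro iffI conjI ballI impI)
  assume "is_singleton {w \<in> carrier_vec n. D *\<^sub>v w = d}"
  then obtain w where w: "{w \<in> carrier_vec n. D *\<^sub>v w = d} = {w}" unfolding is_singleton_def by blast
  then have wc: "w \<in> carrier_vec n" "D *\<^sub>v w = d" by auto
  then show "\<exists>w \<in> carrier_vec n. D *\<^sub>v w = d" by blast
  fix v assume v: "v \<in> carrier_vec n" "D *\<^sub>v v = 0\<^sub>v m"
  \<comment> \<open>The dimension of \<open>d\<close> is read off from the solution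
    \<open>w\<close>.\<close>
  have dc: "d \<in> carrier_vec m" using mult_mat_vec_carrier[OF D wc(1)] wc(2) by simp
  then have "D *\<^sub>v (v + w) = d" using v wc D by (simp add: mult_add_distrib_mat_vec[of _ m n])
  then have "v + w \<in> {w}" using v wc unfolding w[symmetric] by simp
  then show "v = 0\<^sub>v n" using vec_add_diff_cancel(1)[OF v(1) wc(1)] wc(1) by simp
next
  assume a: "(\<exists>w \<in> carrier_vec n. D *\<^sub>v w = d) \<and> (\<forall>v \<in> carrier_vec n. D *\<^sub>v v = 0\<^sub>v m \<longrightarrow> v = 0\<^sub>v n)"
  then obtain w where w: "w \<in> carrier_vec n" "D *\<^sub>v w = d" by blast
  have "y = w" if y: "y \<in> carrier_vec n" "D *\<^sub>v y = d" for y
  proof -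
    \<comment> \<open>Two solutions differ by a kernel vector.\<close>
    have "D *\<^sub>v (y - w) = 0\<^sub>v m"
      using D w y mult_mat_vec_carrier[OF D w(1)] by (simp add: mult_minus_distrib_mat_vec[of _ m n])
    then have "y - w = 0\<^sub>v n" using a w y by simp
    then show ?thesis using vec_add_diff_cancel(2)[OF y(1) w(1)] w(1) by simp
  qed
  then have "{w \<in> carrier_vec n. D *\<^sub>v w = d} = {w}" using w by blast
  then show "is_singleton {w \<in> carrier_vec n. D *\<^sub>v w = d}" unfolding is_singleton_def by blast
qed

text \<open>The spectrum is complex but 1 is real: the determinant commutes with the embedding of
  the reals, so a complex eigenvalue 1 already has a real eigenvector.\<close>

lemma one_in_real_mat_spectrum_iff:
  assumes X: "X \<in> carrier_mat r r"
  shows "1 \<in> real_mat_spectrum X \<longleftrightarrow> (\<exists>v \<in> carrier_vec r. v \<noteq> 0\<^sub>v r \<and> X *\<^sub>v v = v)"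
proof -
  let ?X = "map_mat complex_of_real X"
  have "char_matrix ?X 1 = map_mat complex_of_real (char_matrix X 1)"
    using X unfolding char_matrix_def by (intro eq_matI) auto
  then have "det (char_matrix ?X 1) = complex_of_real (det (char_matrix X 1))"
    by (simp add: of_real_hom.hom_det)
  then have "1 \<in> real_mat_spectrum X \<longleftrightarrow> eigenvalue X 1"
    unfolding real_mat_spectrum_def spectrum_def using eigenvalue_det[of ?X r 1] eigenvalue_det[OF X] X
    by simp
  also have "\<dots> \<longleftrightarrow> (\<exists>v \<in> carrier_vec r. v \<noteq> 0\<^sub>v r \<and> X *\<^sub>v v = v)"
    using X unfolding eigenvalue_def eigenvector_def by auto
  finally show ?thesis .
qed

text \<open>The map from \<open>z\<close> to \<open>E z + e\<close> is a bijection from the fixed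
  points of the loop equation onto \<open>B\<close>, with inverse given by \<open>R\<close>.
  Invertibility of \<open>I - \<Xi>\<close> is expressed by \<open>mat_inverse\<close> returning
  some \<open>J\<close>.\<close>

lemma single_loop_solution:
  assumes loop: "single_loop n B R E e \<Xi> b"
  shows "is_singleton B \<longleftrightarrow> 1 \<notin> real_mat_spectrum \<Xi>" (is ?A)
    and "1 \<notin> real_mat_spectrum \<Xi> \<Longrightarrow>
      \<exists>J. mat_inverse (1\<^sub>m (dim_row R) - \<Xi>) = Some J \<and>
        (\<forall>w \<in> B. R *\<^sub>v w = J *\<^sub>v b \<and> w = E *\<^sub>v (R *\<^sub>v w) + e)" (is "_ \<Longrightarrow> ?J")
proof -
  define r where "r = dim_row R"
  let ?I = "1\<^sub>m r - \<Xi>"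
  have E: "E \<in> carrier_mat n r" and e: "e \<in> carrier_vec n" and \<Xi>: "\<Xi> \<in> carrier_mat r r"
    and b: "b \<in> carrier_vec r" and RE: "R * E = 1\<^sub>m r" and Re: "R *\<^sub>v e = 0\<^sub>v r"
    and sel: "is_selection_mat n R"
    and B: "B = {E *\<^sub>v z + e | z. z \<in> carrier_vec r \<and> z = \<Xi> *\<^sub>v z + b}"
    using loop unfolding single_loop_def r_def by blast+
  have R: "R \<in> carrier_mat r n"
  proof -
    obtain js where "R = mat_of_rows n (map (unit_vec n) js)"
      using sel unfolding is_selection_mat_def by blast
    then have "dim_col R = n" by (simp del: mat_of_rows_map)
    then show ?thesis unfolding r_def by (intro carrier_matI) simp_all
  qed
  have Rw: "R *\<^sub>v (E *\<^sub>v z + e) = z" if z: "z \<in> carrier_vec r" for z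
  proof -
    have "R *\<^sub>v (E *\<^sub>v z + e) = (R * E) *\<^sub>v z + R *\<^sub>v e"
      using R E e z by (simp add: mult_add_distrib_mat_vec[of _ r n])
    then show ?thesis using RE Re z by simp
  qed
  have I: "?I \<in> carrier_mat r r" using \<Xi> by (rule minus_carrier_mat)
  have Iz: "?I *\<^sub>v z = z - \<Xi> *\<^sub>v z" if "z \<in> carrier_vec r" for z
    using that \<Xi> by (simp add: minus_mult_distrib_mat_vec[of _ r r])
  have fix_iff: "z = \<Xi> *\<^sub>v z + b \<longleftrightarrow> ?I *\<^sub>v z = b" if z: "z \<in> carrier_vec r" for z
  proof -
    have c: "\<Xi> *\<^sub>v z \<in> carrier_vec r" using \<Xi> z by simp
    have "z - \<Xi> *\<^sub>v z = b \<longleftrightarrow> z = b + \<Xi> *\<^sub>v z"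
    proof
      assume "z - \<Xi> *\<^sub>v z = b"
      then show "z = b + \<Xi> *\<^sub>v z" using vec_add_diff_cancel(2)[OF z c] by simp
    next
      assume "z = b + \<Xi> *\<^sub>v z"
      then have "z - \<Xi> *\<^sub>v z = b + \<Xi> *\<^sub>v z - \<Xi> *\<^sub>v z" by (rule arg_cong)
      then show "z - \<Xi> *\<^sub>v z = b" unfolding vec_add_diff_cancel(1)[OF b c] .
    qed
    then show ?thesis using Iz[OF z] comm_add_vec[OF b c] by simp
  qed
  have inv: "\<exists>J. mat_inverse ?I = Some J \<and> B = {E *\<^sub>v (J *\<^sub>v b) + e} \<and> J *\<^sub>v b \<in> carrier_vec r"
    if no: "1 \<notin> real_mat_spectrum \<Xi>"
  proof -
    \<comment> \<open>A nonzero kernel vector of \<open>I - \<Xi>\<close> would be an eigenvector of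
      \<open>\<Xi>\<close> for 1.\<close>
    have "v = 0\<^sub>v r" if v: "v \<in> carrier_vec r" "?I *\<^sub>v v = 0\<^sub>v r" for v
    proof -
      have c: "\<Xi> *\<^sub>v v \<in> carrier_vec r" using \<Xi> v by simp
      have "\<Xi> *\<^sub>v v = v" using v Iz vec_add_diff_cancel(2)[OF v(1) c] c by simp
      then show ?thesis using no one_in_real_mat_spectrum_iff[OF \<Xi>] v by blast
    qed
    then have "det ?I \<noteq> 0" using det_0_iff_vec_prod_zero[OF I] by blast
    then have "mat_inverse ?I \<noteq> None"
      using det_non_zero_imp_unit[OF I, of "()"] mat_inverse(1)[OF I, of "()"] by blast
    then obtain J where J: "mat_inverse ?I = Some J" by blast
    then have IJ: "?I * J = 1\<^sub>m r" "J * ?I = 1\<^sub>m r" and Jc: "J \<in> carrier_mat r r"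
      using mat_inverse(2)[OF I] by auto
    have Jb: "J *\<^sub>v b \<in> carrier_vec r" using Jc b by simp
    have "z = \<Xi> *\<^sub>v z + b \<longleftrightarrow> z = J *\<^sub>v b" if z: "z \<in> carrier_vec r" for z
    proof -
      have "J *\<^sub>v (?I *\<^sub>v z) = z" "?I *\<^sub>v (J *\<^sub>v b) = b"
        using assoc_mult_mat_vec[OF Jc I z] assoc_mult_mat_vec[OF I Jc b] IJ z b by auto
      then show ?thesis using fix_iff[OF z] by metis
    qed
    then have "B = {E *\<^sub>v (J *\<^sub>v b) + e}" unfolding B using Jb by blast
    then show ?thesis using J Jb by blast
  qed
  show ?A
  proof
    assume "is_singleton B"
    then obtain w where w: "B = {w}" unfolding is_singleton_def by blast
    then obtain z where z: "z \<in> carrier_vec r" "z = \<Xi> *\<^sub>v z + b" "w = E *\<^sub>v z + e" unfolding B by blast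
    show "1 \<notin> real_mat_spectrum \<Xi>"
    proof
      assume "1 \<in> real_mat_spectrum \<Xi>"
      then obtain v where v: "v \<in> carrier_vec r" "v \<noteq> 0\<^sub>v r" "\<Xi> *\<^sub>v v = v"
        using one_in_real_mat_spectrum_iff[OF \<Xi>] by blast
      \<comment> \<open>An eigenvector \<open>v\<close> for 1 turns the fixed point \<open>z\<close>
        into a second one, \<open>v + z\<close>; applying \<open>R\<close> tells their images in
        \<open>B\<close> apart.\<close>
      have c: "v + z \<in> carrier_vec r" using v z by simp
      have "\<Xi> *\<^sub>v (v + z) + b = v + (\<Xi> *\<^sub>v z + b)"
        using \<Xi> v z(1) b assoc_add_vec[of v r "\<Xi> *\<^sub>v z" b]
        by (simp add: mult_add_distrib_mat_vec[of _ r r])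
      then have "E *\<^sub>v (v + z) + e \<in> B" unfolding B using c z(2) by auto
      then have "E *\<^sub>v (v + z) + e = E *\<^sub>v z + e" using w z by simp
      then have "v + z = z" using Rw[OF c] Rw[OF z(1)] by simp
      then show False using vec_add_diff_cancel(1)[OF v(1) z(1)] z(1) v(2) by simp
    qed
  next
    assume "1 \<notin> real_mat_spectrum \<Xi>"
    then show "is_singleton B" using inv unfolding is_singleton_def by blast
  qed
  show ?J if "1 \<notin> real_mat_spectrum \<Xi>"
    using inv[OF that] Rw unfolding r_def by auto
qed

text \<open>In (i) the components of \<open>B\<close> are reordered, since signals of a program list
  the input first. In (iii) the matrix \<open>J\<close> stands for the inverse of
  \<open>I - \<Xi>\<close>, and \<open>R w\<close> for the selected block.\<close>

theorem proposition2:
  fixes k :: nat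
    and Q :: "nat \<Rightarrow> open_qp"
    and C B :: "real vec set"
    and D0 D :: "real mat" and d0 d :: "real vec"
    and Ds :: "nat \<Rightarrow> real mat" and ds :: "nat \<Rightarrow> real vec"
    and ins outs :: "nat list"
  assumes qp: "\<And>i. i < k \<Longrightarrow> is_open_qp (Q i)"
    and kkt: "\<And>i. i < k \<Longrightarrow> invertible_mat (kkt_mat (Q i))"
    and D0: "D0 \<in> carrier_mat (dim_vec d0) (dim_total k Q)"
    and C: "C = {w \<in> carrier_vec (dim_total k Q). D0 *\<^sub>v w = d0}"
    and Ds: "\<And>i. i < k \<Longrightarrow> Ds i \<in> carrier_mat (dim_vec (ds i)) (dim_sig (Q i))"
    and Bs: "\<And>i. i < k \<Longrightarrow>
               behavior (Q i) = {v \<in> carrier_vec (dim_sig (Q i)). Ds i *\<^sub>v v = ds i}"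
    and B: "B = interconnected_behavior k Q C"
    and D: "D = stack_mat (dim_total k Q) (D0 # map (\<lambda>i. Ds i * proj_mat k Q i) [0..<k])"
    and d: "d = stack_vec (d0 # map ds [0..<k])"
    and part: "index_partition (dim_total k Q) ins outs"
  shows "((\<exists>Q'. is_open_qp Q' \<and> dim_in Q' = length ins \<and> dim_dec Q' = length outs \<and>
                invertible_mat (kkt_mat Q') \<and>
                behavior Q' = (\<lambda>w. select_vec w ins @\<^sub>v select_vec w outs) ` B)
          \<longleftrightarrow> B \<noteq> {} \<and> full_column_rank (select_cols D outs) \<and>
              mat_image (select_cols D ins) \<subseteq> mat_image (select_cols D outs))
       \<and> (is_singleton B \<longleftrightarrow>
            (\<exists>w \<in> carrier_vec (dim_total k Q). D *\<^sub>v w = d) \<and> full_column_rank D)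
       \<and> (\<forall>R E e \<Xi> b. single_loop (dim_total k Q) B R E e \<Xi> b \<longrightarrow>
            (is_singleton B \<longleftrightarrow> 1 \<notin> real_mat_spectrum \<Xi>) \<and>
            (1 \<notin> real_mat_spectrum \<Xi> \<longrightarrow>
               (\<exists>J. mat_inverse (1\<^sub>m (dim_row R) - \<Xi>) = Some J \<and>
                    (\<forall>w \<in> B. R *\<^sub>v w = J *\<^sub>v b \<and> w = E *\<^sub>v (R *\<^sub>v w) + e))))"
proof -
  let ?n = "dim_total k Q" and ?f = "\<lambda>w. select_vec w ins @\<^sub>v select_vec w outs :: real vec"
  have Baff: "B = {w \<in> carrier_vec ?n. D *\<^sub>v w = d}" and Dc: "D \<in> carrier_mat (dim_vec d) ?n"
    using interconnected_behavior_eq_affine[OF D0 Ds Bs D d] unfolding B C by auto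
  have cols: "select_cols D js \<in> carrier_mat (dim_vec d) (length js)" for js
    using select_cols_carrier[of D js] Dc by simp
  have "(\<exists>Q'. is_open_qp Q' \<and> dim_in Q' = length ins \<and> dim_dec Q' = length outs \<and>
          invertible_mat (kkt_mat Q') \<and> behavior Q' = ?f ` B)
      \<longleftrightarrow> ?f ` B \<noteq> {} \<and> full_column_rank (select_cols D outs) \<and>
        mat_image (select_cols D ins) \<subseteq> mat_image (select_cols D outs)"
    by (rule affine_set_is_qp_behavior_iff[OF cols cols carrier_vec_dim_vec])
      (unfold Baff, rule select_image_affine[OF part Dc])
  moreover have "?f ` B \<noteq> {} \<longleftrightarrow> B \<noteq> {}" by simp
  moreover note is_singleton_solution_set_iff[OF Dc, of d, folded Baff] single_loop_solution
  ultimately show ?thesis by blast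
qed

end
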